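(* There exist a subfield $\mathcal{F}\subset\mathbb{R}$ and a matrix $A$ with nonnegative entries in $\mathcal{F}$ such that $$5=\mathrm{rank}(A)=\mathrm{rank}_+(A,\mathbb{R})<\mathrm{rank}_+(A,\mathcal{F})=6.$$
   Context: For a subfield $\mathcal{K}\subset\mathbb{R}$ and a matrix $A$ with nonnegative entries in $\mathcal{K}$, $\mathrm{rank}_+(A,\mathcal{K})$ (the nonnegative rank of $A$ with respect to $\mathcal{K}$) is the smallest integer $k$ such that $A$ can be written as a sum of $k$ rank-one matrices whose entries are nonnegative elements of $\mathcal{K}$. $\mathrm{rank}(A)$ denotes the conventional rank of $A$. *)

theory Defs
  imports
    "HOL-Algebra.Subrings"
    "Jordan_Normal_Form.DL_Rank"
begin

abbreviation mat_rank :: "'a::field mat \<Rightarrow> nat" where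
  "mat_rank A \<equiv> vec_space.rank (dim_row A) A"

definition nonneg_mat_over :: "real set \<Rightarrow> real mat \<Rightarrow> bool" where
  "nonneg_mat_over K A \<longleftrightarrow>
     (\<forall>i<dim_row A. \<forall>j<dim_col A. A $$ (i, j) \<in> K \<and> 0 \<le> A $$ (i, j))"

definition sum_of_nonneg_rank_ones :: "real set \<Rightarrow> real mat \<Rightarrow> nat \<Rightarrow> bool" where
  "sum_of_nonneg_rank_ones K A k \<longleftrightarrow>
     (\<exists>Bs. length Bs = k \<and>
           (\<forall>B \<in> set Bs. B \<in> carrier_mat (dim_row A) (dim_col A) \<and>
                         mat_rank B = 1 \<and> nonneg_mat_over K B) \<and>
           A = foldr (+) Bs (0\<^sub>m (dim_row A) (dim_col A)))"

text \<open>
  If \<open>K\<close> is a subfield of the reals and \<open>A\<close> is nonnegative over \<open>K\<close>, then \<open>A\<close> is the sum of its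
  nonzero entries, each placed in an otherwise zero matrix; so the minimum below is over a
  nonempty set.  Outside that situation the value may be unspecified.
\<close>

definition nonneg_rank :: "real mat \<Rightarrow> real set \<Rightarrow> nat" where
  "nonneg_rank A K = (LEAST k. sum_of_nonneg_rank_ones K A k)"

end

theory Submission
  imports Defs "Jordan_Normal_Form.DL_Rank_Submatrix"
begin

text \<open>
  Take \<open>F = \<rat>\<close> and let \<open>P\<close> be the 4-by-4 matrix with columns \<open>(0,1,3,1)\<close>, \<open>(1,0,1,3)\<close>, \<open>(3,1,0,1)\<close>,
  \<open>(1,3,1,0)\<close>: four points, one on each facet of a tetrahedron.  They lie on the edges of an inscribed
  tetrahedron with vertices \<open>(1,u,0,0)\<close>, \<open>(0,1,u,0)\<close>, \<open>(0,0,1,u)\<close>, \<open>(u,0,0,1)\<close> precisely when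
  \<open>u + 1/u = 3\<close>, which forces \<open>u\<close> to be irrational.  Running the same construction around the cycle from
  a rational starting value fails to close up, but only costs one additional vertex.

  To exclude all other factorizations with four terms, border \<open>P\<close> by two rows (\<open>3(r\<^sub>0 + r\<^sub>2) - (r\<^sub>1 + r\<^sub>3)\<close>
  and its mirror image) and by two columns proportional to \<open>9(c\<^sub>0 + c\<^sub>2) - (c\<^sub>1 + c\<^sub>3)\<close> and its mirror image.
  In a factorization with as many terms as the rank, these linear relations pass to the factors, and
  nonnegativity forces the support of each factor on the indices 0..3 to contain both an even and an odd
  index.  Since \<open>P\<close> vanishes on the diagonal, each term is supported on \<open>S \<times> S\<^sup>c\<close> with \<open>|S| = 2\<close>; the
  entries of \<open>P\<close> next to the diagonal then single out \<open>S = {0,1}, {1,2}, {2,3}, {3,0}\<close>, and the entries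
  of \<open>P\<close> amount to \<open>u\<^sup>2 - 3u + 1 = 0\<close>.  A further diagonal entry 1 (index 4) raises the ranks to 5, 5 and 6.
\<close>

section \<open>The rationals as a subfield of the reals\<close>

lemma subfield_Rats: "subfield (\<rat> :: real set) class_ring"
proof (rule field.subfieldI'[OF class_field])
  show "subring (\<rat> :: real set) class_ring"
    by (rule ring.subringI[OF class_ring.ring_axioms])
      (auto simp: class_ring_simps)
next
  fix k :: real
  assume k: "k \<in> \<rat> - {\<zero>\<^bsub>class_ring\<^esub>}"
  then have "k \<noteq> 0" "k \<in> \<rat>" by (auto simp: class_ring_simps)
  \<comment> \<open>The inverse in \<open>class_ring\<close> is given by a description; uniqueness
    of inverses identifies it with \<open>inverse k\<close>.\<close>
  then have "inv\<^bsub>class_ring\<^esub> k = inverse k"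
    by (intro comm_monoid.comm_inv_char[OF cring.axioms(2)[OF class_cring.cring_axioms]])
      (auto simp: class_ring_simps)
  with \<open>k \<in> \<rat>\<close> show "inv\<^bsub>class_ring\<^esub> k \<in> \<rat>" by simp
qed

section \<open>Rank-one matrices\<close>

text \<open>A nonsingular submatrix has at most as many columns as the rank, so the 2-by-2 submatrix
  on these rows and columns is singular. A kernel vector of it replaces the determinant
  formula.\<close>

lemma rank_one_minor_zero:
  fixes B :: "'a::field mat"
  assumes B: "B \<in> carrier_mat n m" and rk: "mat_rank B = 1"
    and "i < i'" "i' < n" "j < j'" "j' < m"
  shows "B $$ (i, j) * B $$ (i', j') = B $$ (i, j') * B $$ (i', j)"
proof -
  have pick0: "pick {a, b} 0 = a" and pick1: "pick {a, b} (Suc 0) = b" if "a < b" for a b :: nat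
  proof -
    show 0: "pick {a, b} 0 = a" using that by (auto intro!: Least_equality)
    show "pick {a, b} (Suc 0) = b"
      unfolding pick.simps(2) 0 using that by (auto intro!: Least_equality)
  qed
  let ?S = "submatrix B {i, i'} {j, j'}"
  have ci: "{k. k < dim_row B \<and> k \<in> {i, i'}} = {i, i'}"
    and cj: "{k. k < dim_col B \<and> k \<in> {j, j'}} = {j, j'}"
    using assms by auto
  have S: "?S \<in> carrier_mat 2 2"
    using assms dim_submatrix[of B "{i, i'}" "{j, j'}"] unfolding ci cj by (intro carrier_matI) auto
  have ent: "?S $$ (a, b) = B $$ (pick {i, i'} a, pick {j, j'} b)" if "a < 2" "b < 2" for a b
    by (rule submatrix_index; unfold ci cj) (use that assms in auto)
  have "det ?S = 0"
  proof (rule ccontr)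
    assume "det ?S \<noteq> 0"
    from vec_space.rank_gt_minor[OF B this] have "card {k. k < m \<and> k \<in> {j, j'}} \<le> 1"
      using B rk by simp
    moreover have "{k. k < m \<and> k \<in> {j, j'}} = {j, j'}" using assms by auto
    ultimately show False using \<open>j < j'\<close> by simp
  qed
  then obtain v where v: "v \<in> carrier_vec 2" "v \<noteq> 0\<^sub>v 2" and Sv: "?S *\<^sub>v v = 0\<^sub>v 2"
    using det_0_iff_vec_prod_zero_field[OF S] by blast
  have two: "B $$ (k, j) * v $ 0 + B $$ (k, j') * v $ 1 = 0" if "k = i \<or> k = i'" for k
  proof -
    have "?S $$ (a, 0) * v $ 0 + ?S $$ (a, 1) * v $ 1 = 0" if "a < 2" for a
    proof -
      have "(?S *\<^sub>v v) $ a = ?S $$ (a, 0) * v $ 0 + ?S $$ (a, 1) * v $ 1"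
        using carrier_matD[OF S] carrier_vecD[OF v(1)] that
        by (simp add: scalar_prod_def numeral_2_eq_2 del: index_mult_mat_vec)
          (simp add: scalar_prod_def)
      then show ?thesis using Sv that by simp
    qed
    from this[of 0] this[of 1] show ?thesis
      using that pick0[OF \<open>i < i'\<close>] pick1[OF \<open>i < i'\<close>] pick0[OF \<open>j < j'\<close>] pick1[OF \<open>j < j'\<close>]
      by (auto simp: ent simp del: pick.simps)
  qed
  \<comment> \<open>Eliminating one coordinate of \<open>v\<close> from the two kernel equations
    shows that \<open>?d\<close> annihilates the other one; since \<open>v\<close> is nonzero,
    \<open>?d\<close> vanishes.\<close>
  let ?d = "B $$ (i, j) * B $$ (i', j') - B $$ (i, j') * B $$ (i', j)"
  have "?d * v $ 0 = 0" "?d * v $ 1 = 0"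
  proof -
    have "B $$ (k, j) * v $ 0 = - (B $$ (k, j') * v $ 1)" if "k = i \<or> k = i'" for k
      using two[OF that] by (simp add: eq_neg_iff_add_eq_0)
    note eqs = this[of i, simplified] this[of i', simplified]
    have "?d * v $ 0 = B $$ (i', j') * (B $$ (i, j) * v $ 0) - B $$ (i, j') * (B $$ (i', j) * v $ 0)"
      by (simp add: algebra_simps)
    also have "\<dots> = 0" unfolding eqs by (simp add: mult_ac)
    finally show "?d * v $ 0 = 0" .
    have "?d * v $ 1 = B $$ (i, j) * (B $$ (i', j') * v $ 1) - B $$ (i', j) * (B $$ (i, j') * v $ 1)"
      by (simp add: algebra_simps)
    also have "\<dots> = B $$ (i', j) * (B $$ (i, j) * v $ 0) - B $$ (i, j) * (B $$ (i', j) * v $ 0)"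
      using eqs by (simp add: minus_equation_iff)
    also have "\<dots> = 0" by (simp add: mult_ac)
    finally show "?d * v $ 1 = 0" .
  qed
  moreover have "v $ 0 \<noteq> 0 \<or> v $ 1 \<noteq> 0"
    using v by (auto simp: vec_eq_iff numeral_2_eq_2 less_Suc_eq)
  ultimately show ?thesis by auto
qed

lemma rank_one_cross:
  fixes B :: "'a::field mat"
  assumes B: "B \<in> carrier_mat n m" and rk: "mat_rank B = 1"
    and "i < n" "i' < n" "j < m" "j' < m"
  shows "B $$ (i, j) * B $$ (i', j') = B $$ (i, j') * B $$ (i', j)"
proof -
  note minor = rank_one_minor_zero[OF B rk]
  consider "i = i' \<or> j = j'" | "i < i'" "j < j'" | "i < i'" "j' < j" | "i' < i" "j < j'" | "i' < i" "j' < j"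
    by linarith
  then show ?thesis
  proof cases
    case 1
    then show ?thesis by (auto simp: mult.commute)
  next
    case 2
    then show ?thesis using minor[of i i' j j'] assms by simp
  next
    case 3
    then show ?thesis using minor[of i i' j' j] assms by simp
  next
    case 4
    then show ?thesis using minor[of i' i j j'] assms by (simp add: mult.commute)
  next
    case 5
    then show ?thesis using minor[of i' i j' j] assms by (simp add: mult.commute)
  qed
qed

lemma rank_one_nonzero_entry:
  fixes B :: "'a::field mat"
  assumes B: "B \<in> carrier_mat n m" and rk: "mat_rank B = 1"
  obtains i j where "i < n" "j < m" "B $$ (i, j) \<noteq> 0"
proof -
  have "B \<noteq> 0\<^sub>m n m"
    using rk B by (auto simp: vec_space.rank_0I)
  then show thesis using B that by (metis carrier_matD eq_matI index_zero_mat)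
qed

text \<open>A nonzero 1-by-1 minor bounds the rank from below, the product form of the entries from
  above.\<close>

lemma mat_rank_outer_product:
  fixes a b :: "nat \<Rightarrow> 'a::field"
  assumes "i < n" "j < m" "a i \<noteq> 0" "b j \<noteq> 0"
  shows "mat_rank (mat n m (\<lambda>(i, j). a i * b j)) = 1"
proof -
  let ?B = "mat n m (\<lambda>(i, j). a i * b j)"
  have ci: "{k. k < dim_row ?B \<and> k \<in> {i}} = {i}" and cj: "{k. k < dim_col ?B \<and> k \<in> {j}} = {j}"
    using assms by auto
  let ?S = "submatrix ?B {i} {j}"
  have S: "?S \<in> carrier_mat 1 1"
    using dim_submatrix[of ?B "{i}" "{j}"] unfolding ci cj by (intro carrier_matI) auto
  have "?S $$ (0, 0) = ?B $$ (pick {i} 0, pick {j} 0)"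
    by (rule submatrix_index; unfold ci cj) auto
  moreover have "pick {i} 0 = i" "pick {j} 0 = j" by (auto intro!: Least_equality)
  ultimately have "det ?S \<noteq> 0"
    using assms S by (simp add: det_single del: pick.simps)
  from vec_space.rank_gt_minor[OF _ this, of n m] have "1 \<le> mat_rank ?B"
    using cj by simp
  moreover have "mat_rank ?B \<le> 1"
    using vec_space.rank_le_1_product_entries[of ?B n m a b] by simp
  ultimately show ?thesis by simp
qed

section \<open>Sums of rank-one matrices as entrywise factorizations\<close>

lemma foldr_mat_add:
  assumes "set Bs \<subseteq> carrier_mat n m"
  shows "foldr (+) Bs (0\<^sub>m n m) \<in> carrier_mat n m"
  using assms by (induction Bs) auto

lemma foldr_mat_add_index:
  assumes "set Bs \<subseteq> carrier_mat n m" "i < n" "j < m"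
  shows "foldr (+) Bs (0\<^sub>m n m) $$ (i, j) = (\<Sum>B\<leftarrow>Bs. B $$ (i, j))"
  using assms(1)
proof (induction Bs)
  case (Cons B Bs)
  then show ?case
    using foldr_mat_add[of Bs n m] assms(2,3) by (simp add: carrier_matD)
qed (use assms in simp)

lemma mat_rank_foldr_add:
  fixes Bs :: "'a::field mat list"
  assumes "\<And>B. B \<in> set Bs \<Longrightarrow> B \<in> carrier_mat n m \<and> mat_rank B = 1"
  shows "mat_rank (foldr (+) Bs (0\<^sub>m n m)) \<le> length Bs"
  using assms
proof (induction Bs)
  case Nil
  then show ?case by (simp add: vec_space.rank_0I)
next
  case (Cons B Bs)
  let ?C = "foldr (+) Bs (0\<^sub>m n m)"
  have B: "B \<in> carrier_mat n m" "mat_rank B = 1" using Cons.prems by auto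
  have "?C \<in> carrier_mat n m" using Cons.prems by (intro foldr_mat_add) auto
  moreover have "vec_space.rank n ?C \<le> length Bs" using Cons calculation by auto
  moreover have "vec_space.rank n B = 1" using B by (metis carrier_matD(1))
  ultimately show ?case
    using B(1) vec_space.rank_subadditive[of B n m ?C] by (auto dest!: carrier_matD(1))
qed

text \<open>Subadditivity of the rank. As \<open>K\<close> is arbitrary, this bounds the nonnegative
  ranks over both fields from below.\<close>

lemma rank_le_sum_of_nonneg_rank_ones:
  assumes "sum_of_nonneg_rank_ones K A k"
  shows "mat_rank A \<le> k"
proof -
  from assms obtain Bs where Bs: "length Bs = k"
    "\<And>B. B \<in> set Bs \<Longrightarrow> B \<in> carrier_mat (dim_row A) (dim_col A) \<and> mat_rank B = 1"
    "A = foldr (+) Bs (0\<^sub>m (dim_row A) (dim_col A))"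
    unfolding sum_of_nonneg_rank_ones_def by blast
  show ?thesis
    using mat_rank_foldr_add[of Bs "dim_row A" "dim_col A"] Bs by simp
qed

text \<open>A rank-one term is its column through a nonzero entry times the row through that entry,
  divided by the entry; closure under division keeps both factors in \<open>K\<close>.\<close>

lemma sum_of_nonneg_rank_onesE:
  assumes "sum_of_nonneg_rank_ones K A r"
    and closed: "\<And>x y. x \<in> K \<Longrightarrow> y \<in> K \<Longrightarrow> x / y \<in> K"
  obtains w h :: "nat \<Rightarrow> nat \<Rightarrow> real"
  where "\<And>k i. k < r \<Longrightarrow> i < dim_row A \<Longrightarrow> w k i \<in> K \<and> 0 \<le> w k i"
    and "\<And>k j. k < r \<Longrightarrow> j < dim_col A \<Longrightarrow> h k j \<in> K \<and> 0 \<le> h k j"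
    and "\<And>i j. i < dim_row A \<Longrightarrow> j < dim_col A \<Longrightarrow> A $$ (i, j) = (\<Sum>k<r. w k i * h k j)"
proof -
  let ?n = "dim_row A" and ?m = "dim_col A"
  from assms obtain Bs where len: "length Bs = r"
    and Bs: "\<And>B. B \<in> set Bs \<Longrightarrow> B \<in> carrier_mat ?n ?m \<and> mat_rank B = 1 \<and> nonneg_mat_over K B"
    and A: "A = foldr (+) Bs (0\<^sub>m ?n ?m)"
    unfolding sum_of_nonneg_rank_ones_def by blast
  have "\<exists>a b. (\<forall>i<?n. a i \<in> K \<and> 0 \<le> a i) \<and> (\<forall>j<?m. b j \<in> K \<and> 0 \<le> b j) \<and>
      (\<forall>i<?n. \<forall>j<?m. B $$ (i, j) = a i * b j)"
    if "B \<in> set Bs" for B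
  proof -
    have B: "B \<in> carrier_mat ?n ?m" "mat_rank B = 1" "nonneg_mat_over K B" using Bs that by auto
    obtain p q where pq: "p < ?n" "q < ?m" "B $$ (p, q) \<noteq> 0"
      using rank_one_nonzero_entry[OF B(1,2)] .
    have K: "B $$ (i, j) \<in> K" "0 \<le> B $$ (i, j)" if "i < ?n" "j < ?m" for i j
      using that B unfolding nonneg_mat_over_def by auto
    show ?thesis
      using pq K closed rank_one_cross[OF B(1,2) _ pq(1) _ pq(2)]
      by (intro exI[of _ "\<lambda>i. B $$ (i, q)"] exI[of _ "\<lambda>j. B $$ (p, j) / B $$ (p, q)"])
        (auto simp: field_simps)
  qed
  then obtain a b where ab: "\<And>B i. B \<in> set Bs \<Longrightarrow> i < ?n \<Longrightarrow> a B i \<in> K \<and> 0 \<le> a B i"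
      "\<And>B j. B \<in> set Bs \<Longrightarrow> j < ?m \<Longrightarrow> b B j \<in> K \<and> 0 \<le> b B j"
      "\<And>B i j. B \<in> set Bs \<Longrightarrow> i < ?n \<Longrightarrow> j < ?m \<Longrightarrow> B $$ (i, j) = a B i * b B j"
    by metis
  show thesis
  proof
    show "A $$ (i, j) = (\<Sum>k<r. a (Bs ! k) i * b (Bs ! k) j)" if "i < ?n" "j < ?m" for i j
    proof -
      have "A $$ (i, j) = (\<Sum>B\<leftarrow>Bs. B $$ (i, j))"
        by (subst A, rule foldr_mat_add_index) (use Bs that in auto)
      also have "\<dots> = (\<Sum>k<r. (Bs ! k) $$ (i, j))"
        by (simp add: sum_list_sum_nth len atLeast0LessThan)
      also have "\<dots> = (\<Sum>k<r. a (Bs ! k) i * b (Bs ! k) j)"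
        using ab(3) that len by (intro sum.cong) auto
      finally show ?thesis .
    qed
  qed (use ab(1,2) len in auto)
qed

text \<open>The condition \<open>ne\<close> excludes zero terms, whose rank would be 0 instead of
  the prescribed 1.\<close>

lemma sum_of_nonneg_rank_onesI:
  fixes w h :: "nat \<Rightarrow> nat \<Rightarrow> real"
  assumes A: "A \<in> carrier_mat n m"
    and wh: "\<And>k i j. k < r \<Longrightarrow> i < n \<Longrightarrow> j < m \<Longrightarrow> w k i * h k j \<in> K \<and> 0 \<le> w k i * h k j"
    and ne: "\<And>k. k < r \<Longrightarrow> \<exists>i<n. \<exists>j<m. w k i \<noteq> 0 \<and> h k j \<noteq> 0"
    and eq: "\<And>i j. i < n \<Longrightarrow> j < m \<Longrightarrow> A $$ (i, j) = (\<Sum>k<r. w k i * h k j)"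
  shows "sum_of_nonneg_rank_ones K A r"
proof -
  let ?B = "\<lambda>k. mat n m (\<lambda>(i, j). w k i * h k j)"
  let ?Bs = "map ?B [0..<r]"
  have sub: "set ?Bs \<subseteq> carrier_mat n m" by auto
  have "A = foldr (+) ?Bs (0\<^sub>m n m)"
  proof (rule eq_matI)
    fix i j
    assume "i < dim_row (foldr (+) ?Bs (0\<^sub>m n m))" "j < dim_col (foldr (+) ?Bs (0\<^sub>m n m))"
    then have ij: "i < n" "j < m" using foldr_mat_add[OF sub] by auto
    show "A $$ (i, j) = foldr (+) ?Bs (0\<^sub>m n m) $$ (i, j)"
      unfolding foldr_mat_add_index[OF sub ij] eq[OF ij]
      using ij by (simp add: sum_list_sum_nth atLeast0LessThan o_def)
  qed (use A foldr_mat_add[OF sub] in auto)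
  moreover have "mat_rank (?B k) = 1" if "k < r" for k
    using ne[OF that] mat_rank_outer_product by blast
  ultimately show ?thesis
    unfolding sum_of_nonneg_rank_ones_def using A wh
    by (intro exI[of _ ?Bs]) (auto simp: nonneg_mat_over_def)
qed

section \<open>Linear relations passing to the factors\<close>

text \<open>The matrix is a product \<open>W * H\<close>, so \<open>H\<close> is nonsingular by
  multiplicativity of the determinant, and \<open>y\<close> lies in its left kernel.\<close>

lemma left_kernel_trivial:
  fixes w h :: "nat \<Rightarrow> nat \<Rightarrow> 'a::field"
  assumes det: "det (mat n n (\<lambda>(i, j). \<Sum>k<n. w k i * h k j)) \<noteq> 0"
    and ker: "\<And>j. j < n \<Longrightarrow> (\<Sum>k<n. y k * h k j) = 0" and "k < n"
  shows "y k = 0"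
proof -
  define W where "W = mat n n (\<lambda>(i, k). w k i)"
  define H where "H = mat n n (\<lambda>(k, j). h k j)"
  have car: "W \<in> carrier_mat n n" "H \<in> carrier_mat n n" by (simp_all add: W_def H_def)
  have "mat n n (\<lambda>(i, j). \<Sum>k<n. w k i * h k j) = W * H"
    by (rule eq_matI) (auto simp: W_def H_def scalar_prod_def atLeast0LessThan)
  with det have "det (transpose_mat H) \<noteq> 0"
    using det_mult[OF car] det_transpose[OF car(2)] by auto
  moreover have "transpose_mat H *\<^sub>v vec n y = 0\<^sub>v n"
    using ker by (intro eq_vecI) (auto simp: H_def scalar_prod_def atLeast0LessThan mult.commute)
  ultimately have "vec n y = 0\<^sub>v n"
    using det_0_iff_vec_prod_zero_field[of "transpose_mat H" n] car by (metis transpose_carrier_mat vec_carrier)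
  then show ?thesis
    using \<open>k < n\<close> by (metis index_vec index_zero_vec(1))
qed

text \<open>Let \<open>y k\<close> be the combination of the entries of \<open>w k\<close>. The
  relation on the first \<open>n\<close> columns says that \<open>y\<close> is in the left kernel of
  the leading square part of \<open>h\<close>, which is nonsingular because the number of terms
  equals the size of the nonsingular minor.\<close>

lemma row_relation_transfers:
  fixes w h :: "nat \<Rightarrow> nat \<Rightarrow> 'a::field"
  assumes eq: "\<And>i j. i < N \<Longrightarrow> j < N \<Longrightarrow> A i j = (\<Sum>k<n. w k i * h k j)" and "n \<le> N"
    and det: "det (mat n n (\<lambda>(i, j). A i j)) \<noteq> 0"
    and rel: "\<And>j. j < n \<Longrightarrow> (\<Sum>i<N. c i * A i j) = 0" and "k < n"
  shows "(\<Sum>i<N. c i * w k i) = 0"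
proof (rule left_kernel_trivial[where n = n and h = h and w = w and k = k
      and y = "\<lambda>k. \<Sum>i<N. c i * w k i"])
  have "mat n n (\<lambda>(i, j). A i j) = mat n n (\<lambda>(i, j). \<Sum>k<n. w k i * h k j)"
    using eq \<open>n \<le> N\<close> by (intro eq_matI) auto
  with det show "det (mat n n (\<lambda>(i, j). \<Sum>k<n. w k i * h k j)) \<noteq> 0" by simp
next
  fix j
  assume "j < n"
  have "(\<Sum>k<n. (\<Sum>i<N. c i * w k i) * h k j) = (\<Sum>i<N. c i * (\<Sum>k<n. w k i * h k j))"
    unfolding sum_distrib_left sum_distrib_right by (subst sum.swap) (simp add: mult.assoc)
  also have "\<dots> = (\<Sum>i<N. c i * A i j)"
    using eq \<open>j < n\<close> \<open>n \<le> N\<close> by (intro sum.cong) auto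
  finally show "(\<Sum>k<n. (\<Sum>i<N. c i * w k i) * h k j) = 0" using rel \<open>j < n\<close> by simp
qed fact

section \<open>The matrix and its rank\<close>

lemma less_7_cases: "i < 7 \<longleftrightarrow> i = 0 \<or> i = 1 \<or> i = 2 \<or> i = 3 \<or> i = 4 \<or> i = 5 \<or> i = (6::nat)"
  by arith

lemma less_4_cases: "i < 4 \<longleftrightarrow> i = 0 \<or> i = 1 \<or> i = 2 \<or> i = (3::nat)"
  by arith

lemma less_5_cases: "i < 5 \<longleftrightarrow> i = 0 \<or> i = 1 \<or> i = 2 \<or> i = 3 \<or> i = (4::nat)"
  by arith

lemma sum_7: "(\<Sum>i<7. f i) = f 0 + f 1 + f 2 + f 3 + f 4 + f 5 + f (6::nat)" for f :: "nat \<Rightarrow> real"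
  by (simp add: eval_nat_numeral)

text \<open>Indices 0..3 carry \<open>P\<close> in cyclic order, 4 is the additional diagonal entry,
  5 and 6 are the border; the border columns are the stated combinations divided by 5. Nested lists
  let simp evaluate each entry.\<close>

definition gap_entry :: "nat \<Rightarrow> nat \<Rightarrow> real" where
  "gap_entry i j =
     [[0, 1, 3, 1, 0,  5,  3],
      [1, 0, 1, 3, 0,  3,  5],
      [3, 1, 0, 1, 0,  5,  3],
      [1, 3, 1, 0, 0,  3,  5],
      [0, 0, 0, 0, 1,  0,  0],
      [7, 3, 7, 3, 0, 24,  8],
      [3, 7, 3, 7, 0,  8, 24]] ! i ! j"

definition gap_mat :: "real mat" where
  "gap_mat = mat 7 7 (\<lambda>(i, j). gap_entry i j)"

lemma det_gap_minor: "det (mat 5 5 (\<lambda>(i, j). gap_entry i j)) \<noteq> 0"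
proof
  let ?G = "mat 5 5 (\<lambda>(i, j). gap_entry i j)"
  assume "det ?G = 0"
  then obtain v where v: "v \<in> carrier_vec 5" "v \<noteq> 0\<^sub>v 5" "?G *\<^sub>v v = 0\<^sub>v 5"
    using det_0_iff_vec_prod_zero_field[of ?G 5] by auto
  have "(?G *\<^sub>v v) $ i = (\<Sum>j<5. gap_entry i j * v $ j)" if "i < 5" for i
    using that v(1) by (simp add: scalar_prod_def atLeast0LessThan)
  then have *: "(\<Sum>j<5. gap_entry i j * v $ j) = 0" if "i < 5" for i
    using that v(3) by simp
  \<comment> \<open>The kernel equations written out; solving them by linear arithmetic replaces a
    determinant expansion.\<close>
  have "v $ 1 + 3 * v $ 2 + v $ 3 = 0" "v $ 0 + v $ 2 + 3 * v $ 3 = 0" "3 * v $ 0 + v $ 1 + v $ 3 = 0"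
    "v $ 0 + 3 * v $ 1 + v $ 2 = 0" "v $ 4 = 0"
    using *[of 0] *[of 1] *[of 2] *[of 3] *[of 4] by (simp_all add: gap_entry_def eval_nat_numeral)
  then have "v $ 0 = 0" "v $ 1 = 0" "v $ 2 = 0" "v $ 3 = 0" "v $ 4 = 0" by linarith+
  then have "v = 0\<^sub>v 5"
    using v(1) by (intro eq_vecI) (auto simp: eval_nat_numeral less_Suc_eq)
  with v(2) show False by simp
qed

lemma pick_lessThan: "i < n \<Longrightarrow> pick {..<n} i = i"
proof (induction i)
  case 0
  then show ?case by (simp add: Least_equality)
next
  case (Suc i)
  then have "pick {..<n} i = i" by simp
  with Suc.prems show ?case by (auto intro!: Least_equality)
qed

text \<open>The leading 5-by-5 minor gives this bound; the matching upper bound will come from the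
  real decomposition into five terms.\<close>

lemma rank_gap_mat_ge: "5 \<le> mat_rank gap_mat"
proof -
  have I: "{i. i < dim_row gap_mat \<and> i \<in> {..<5}} = {..<5}" "{i. i < dim_col gap_mat \<and> i \<in> {..<5}} = {..<5}"
    by (auto simp: gap_mat_def)
  have "submatrix gap_mat {..<5} {..<5} = mat 5 5 (\<lambda>(i, j). gap_entry i j)"
    unfolding submatrix_def I by (rule eq_matI) (auto simp: pick_lessThan gap_mat_def)
  then have "det (submatrix gap_mat {..<5} {..<5}) \<noteq> 0" using det_gap_minor by simp
  from vec_space.rank_gt_minor[OF _ this, of 7 7] I show ?thesis by (simp add: gap_mat_def)
qed

section \<open>The quadratic equation and the cycle leading to it\<close>

lemma no_rational_root: "x\<^sup>2 - 3 * x + 1 \<noteq> 0" if "x \<in> \<rat>" for x :: real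
proof
  assume eq: "x\<^sup>2 - 3 * x + 1 = 0"
  from \<open>x \<in> \<rat>\<close> obtain m n :: nat where n: "n \<noteq> 0" and x: "\<bar>x\<bar> = m / n" and cop: "coprime m n"
    by (rule Rats_abs_nat_div_natE)
  have "x \<ge> 0" using eq zero_le_power2[of x] by linarith
  with x have "x = m / n" by simp
  with eq n have "real m ^ 2 - 3 * m * n + real n ^ 2 = 0"
    by (simp add: field_simps power2_eq_square)
  then have "real (m\<^sup>2 + n\<^sup>2) = real (3 * m * n)" by simp
  then have "m\<^sup>2 + n\<^sup>2 = 3 * m * n" by (simp only: of_nat_eq_iff)
  then have "even m \<and> even n" by (metis even_add even_mult_iff even_power odd_numeral pos2)
  with cop show False using coprime_common_divisor[of m n 2] by auto
qed

text \<open>One step of the map \<open>a \<mapsto> 3 - 1 / a\<close> on fractions: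
  \<open>q / p\<close> becomes \<open>(3 * q - p) / q\<close>. The form without division avoids
  showing that denominators are nonzero.\<close>

lemma cycle_step:
  fixes p :: real
  assumes "p * a = q" "a * a' = 1" "a' + b = 3"
  shows "q * b = 3 * q - p"
proof -
  have "q * a' = p * (a * a')" using assms(1) by (simp flip: mult.assoc)
  moreover have "q * b = q * 3 - q * a'" using assms(3) by (simp flip: right_diff_distrib)
  ultimately show ?thesis using assms(2) by simp
qed

text \<open>Four steps of the map return to \<open>x\<close>. Numerators and denominators run
  through \<open>1\<close>, \<open>x\<close>, \<open>3 * x - 1\<close>, \<open>8 * x - 3\<close>,
  and so on, with every second Fibonacci number as coefficient; the closing identity is 21 times the
  claim.\<close>

lemma cycle_equation:
  fixes x :: real
  assumes "x * x' = 1" "y * y' = 1" "e * e' = 1" "d * d' = 1"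
    and "x' + y = 3" "y' + e = 3" "e' + d = 3" "d' + x = 3"
  shows "x\<^sup>2 - 3 * x + 1 = 0"
proof -
  have "x * y = 3 * x - 1" using cycle_step[of 1 x x x' y] assms by simp
  then have "(3 * x - 1) * e = 8 * x - 3" using cycle_step[of x y _ y' e] assms by simp
  then have "(8 * x - 3) * d = 21 * x - 8" using cycle_step[of _ e _ e' d] assms by fastforce
  then have "(21 * x - 8) * x = 55 * x - 21" using cycle_step[of _ d _ d' x] assms by fastforce
  then show ?thesis by (simp add: algebra_simps power2_eq_square)
qed

text \<open>For the 2-by-2 block of one term: if the two entries on one diagonal are 1, those on the
  other are mutually inverse.\<close>

lemma mult_one_cross: "(r * q) * (p * s) = 1" if "p * q = 1" "r * s = 1" for p :: real
proof -
  have "(r * q) * (p * s) = (p * q) * (r * s)" by (simp only: mult_ac)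
  then show ?thesis using that by simp
qed

section \<open>No rational factorization with five terms\<close>

lemma gap_entries_factorization_not_rational:
  fixes w h :: "nat \<Rightarrow> nat \<Rightarrow> real"
  assumes w: "\<And>k i. k < 5 \<Longrightarrow> i < 7 \<Longrightarrow> w k i \<in> \<rat> \<and> 0 \<le> w k i"
    and h: "\<And>k j. k < 5 \<Longrightarrow> j < 7 \<Longrightarrow> h k j \<in> \<rat> \<and> 0 \<le> h k j"
    and eq: "\<And>i j. i < 7 \<Longrightarrow> j < 7 \<Longrightarrow> gap_entry i j = (\<Sum>k<5. w k i * h k j)"
  shows False
proof -
  let ?det = "\<lambda>A. det (mat 5 5 (\<lambda>(i, j). A i j)) \<noteq> 0"
  \<comment> \<open>Column relations are row relations of the transposed factorization, in which
    \<open>w\<close> and \<open>h\<close> change places.\<close>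
  have eqT: "gap_entry j i = (\<Sum>k<5. h k i * w k j)" if "i < 7" "j < 7" for i j
    using eq[OF that(2,1)] by (simp add: mult.commute)
  have detT: "?det (\<lambda>i j. gap_entry j i)"
  proof -
    have "mat 5 5 (\<lambda>(i, j). gap_entry j i) = transpose_mat (mat 5 5 (\<lambda>(i, j). gap_entry i j))"
      by (rule eq_matI) auto
    then show ?thesis using det_gap_minor det_transpose by (metis mat_carrier)
  qed
  have row: "(\<Sum>i<7. c i * w k i) = 0"
    if "\<forall>j\<in>{0, 1, 2, 3, 4}. (\<Sum>i<7. c i * gap_entry i j) = 0" "k < 5" for c k
    using row_relation_transfers[where N = 7 and A = gap_entry and n = 5
      and w = w and h = h and c = c and k = k] eq det_gap_minor that by (simp add: less_5_cases)
  have col: "(\<Sum>j<7. c j * h k j) = 0"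
    if "\<forall>i\<in>{0, 1, 2, 3, 4}. (\<Sum>j<7. c j * gap_entry i j) = 0" "k < 5" for c k
    using row_relation_transfers[where N = 7 and A = "\<lambda>i j. gap_entry j i" and n = 5
      and w = h and h = w and c = c and k = k] eqT detT that by (simp add: less_5_cases)

  \<comment> \<open>The coefficient lists encode the relations that define the border rows and
    columns.\<close>
  have w5: "w k 5 = 3 * (w k 0 + w k 2) - (w k 1 + w k 3)" if "k < 5" for k
    using row[of "\<lambda>i. [-3, 1, -3, 1, 0, 1, 0] ! i" k] that
    by (simp add: sum_7 gap_entry_def)
  have w6: "w k 6 = 3 * (w k 1 + w k 3) - (w k 0 + w k 2)" if "k < 5" for k
    using row[of "\<lambda>i. [1, -3, 1, -3, 0, 0, 1] ! i" k] that
    by (simp add: sum_7 gap_entry_def)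
  have h5: "5 * h k 5 = 9 * (h k 0 + h k 2) - (h k 1 + h k 3)" if "k < 5" for k
    using col[of "\<lambda>i. [-9, 1, -9, 1, 0, 5, 0] ! i" k] that
    by (simp add: sum_7 gap_entry_def)
  have h6: "5 * h k 6 = 9 * (h k 1 + h k 3) - (h k 0 + h k 2)" if "k < 5" for k
    using col[of "\<lambda>i. [1, -9, 1, -9, 0, 0, 5] ! i" k] that
    by (simp add: sum_7 gap_entry_def)
  \<comment> \<open>By nonnegativity at 5 and 6, three times (for \<open>h\<close>: nine times)
    either parity sum dominates the other one, so if one vanishes, both do.\<close>
  have w_parity: "0 < w k 0 + w k 2 \<and> 0 < w k 1 + w k 3" if "0 < w k 0 + w k 1 + w k 2 + w k 3" "k < 5" for k
    using that w[of k 5] w[of k 6] w5[of k] w6[of k] by auto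
  have h_parity: "0 < h k 0 + h k 2 \<and> 0 < h k 1 + h k 3" if "0 < h k 0 + h k 1 + h k 2 + h k 3" "k < 5" for k
    using that h[of k 5] h[of k 6] h5[of k] h6[of k] by auto
  have zero: "w k i * h k j = 0" if "gap_entry i j = 0" "k < 5" "i < 7" "j < 7" for i j k
  proof -
    have "(\<Sum>k<5. w k i * h k j) = 0" using eq that by simp
    then show ?thesis
      using sum_nonneg_eq_0_iff[of "{..<5}" "\<lambda>k. w k i * h k j"] w h that by simp
  qed
  have pos: "\<exists>k<5. 0 < w k i \<and> 0 < h k j" if "0 < gap_entry i j" "i < 7" "j < 7" for i j
  proof -
    have "(\<Sum>k<5. w k i * h k j) \<noteq> 0" using eq that by simp
    then obtain k where "k < 5" "w k i * h k j \<noteq> 0"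
      by (auto elim: sum.not_neutral_contains_not_neutral)
    with w[of k i] h[of k j] that show ?thesis by (intro exI[of _ k]) (simp add: less_le)
  qed
  have diag: "w k i = 0 \<or> h k i = 0" if "k < 5" "i < 4" for k i
  proof -
    have "gap_entry i i = 0" using that(2) by (auto simp: gap_entry_def less_4_cases)
    then show ?thesis using zero[of i i k] that by simp
  qed

  \<comment> \<open>The tuples are the cyclic shifts of (0,1,2,3). The positive entry at
    \<open>(q, r)\<close> provides a term, and the zero diagonal gives \<open>w k r = 0\<close> and
    \<open>h k q = 0\<close>. Parity then makes \<open>w k p\<close> and \<open>h k s\<close>
    positive, and the diagonal gives the remaining two zeros.\<close>
  have shape: "\<exists>k<5. 0 < w k p \<and> 0 < w k q \<and> w k r = 0 \<and> w k s = 0 \<and>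
      h k p = 0 \<and> h k q = 0 \<and> 0 < h k r \<and> 0 < h k s"
    if pqrs: "(p, q, r, s) \<in> {(0, 1, 2, 3), (1, 2, 3, 0), (2, 3, 0, 1), (3, 0, 1, 2)}" for p q r s
  proof -
    have "0 < gap_entry q r" "p < 4" "q < 4" "r < 4" "s < 4"
      using pqrs by (auto simp: gap_entry_def)
    then obtain k where k: "k < 5" "0 < w k q" "0 < h k r" using pos[of q r] by auto
    then have "w k r = 0" "h k q = 0"
      using diag[of k q] diag[of k r] \<open>q < 4\<close> \<open>r < 4\<close> by auto
    have nn: "0 \<le> w k p" "0 \<le> w k s" "0 \<le> h k p" "0 \<le> h k s"
      using w[of k p] w[of k s] h[of k p] h[of k s] k(1) \<open>p < 4\<close> \<open>s < 4\<close> by auto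
    have total: "f 0 + f 1 + f 2 + f 3 = f p + f q + f r + f s" for f :: "nat \<Rightarrow> real"
      using pqrs by auto
    \<comment> \<open>Two cases, as \<open>p\<close> may be even or odd; \<open>p\<close> and
      \<open>r\<close> always share a parity, as do \<open>q\<close> and \<open>s\<close>.\<close>
    have parity: "f 0 + f 2 = f p + f r \<and> f 1 + f 3 = f q + f s \<or>
        f 0 + f 2 = f q + f s \<and> f 1 + f 3 = f p + f r" for f :: "nat \<Rightarrow> real"
      using pqrs by auto
    have "0 < w k 0 + w k 1 + w k 2 + w k 3" "0 < h k 0 + h k 1 + h k 2 + h k 3"
      using k(2,3) nn \<open>w k r = 0\<close> \<open>h k q = 0\<close> unfolding total by linarith+
    from w_parity[OF this(1) k(1)] h_parity[OF this(2) k(1)]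
    have "0 < w k p" "0 < h k s"
      using parity[of "w k"] parity[of "h k"] \<open>w k r = 0\<close> \<open>h k q = 0\<close> by auto
    with diag[of k p] diag[of k s] k \<open>w k r = 0\<close> \<open>h k q = 0\<close> \<open>p < 4\<close> \<open>s < 4\<close>
    show ?thesis by (intro exI[of _ k]) auto
  qed
  obtain a where a: "a < 5" "0 < w a 0" "0 < w a 1" "w a 2 = 0" "w a 3 = 0"
      "h a 0 = 0" "h a 1 = 0" "0 < h a 2" "0 < h a 3"
    using shape[of 0 1 2 3] by auto
  obtain b where b: "b < 5" "0 < w b 1" "0 < w b 2" "w b 3 = 0" "w b 0 = 0"
      "h b 1 = 0" "h b 2 = 0" "0 < h b 3" "0 < h b 0"
    using shape[of 1 2 3 0] by auto
  obtain c where c: "c < 5" "0 < w c 2" "0 < w c 3" "w c 0 = 0" "w c 1 = 0"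
      "h c 2 = 0" "h c 3 = 0" "0 < h c 0" "0 < h c 1"
    using shape[of 2 3 0 1] by auto
  obtain d where d: "d < 5" "0 < w d 3" "0 < w d 0" "w d 1 = 0" "w d 2 = 0"
      "h d 3 = 0" "h d 0 = 0" "0 < h d 1" "0 < h d 2"
    using shape[of 3 0 1 2] by auto
  obtain z where z: "z < 5" "0 < w z 4" "0 < h z 4"
    using pos[of 4 4] by (auto simp: gap_entry_def)
  \<comment> \<open>Column 4 vanishes in rows 0..3 while \<open>h z 4\<close> is positive, so term
    \<open>z\<close> contributes nothing to \<open>P\<close>.\<close>
  have wz: "w z i = 0" if "i < 4" for i
    using zero[of i 4 z] that z by (auto simp: gap_entry_def less_4_cases)
  have "a \<noteq> b" "a \<noteq> c" "a \<noteq> d" "b \<noteq> c" "b \<noteq> d" "c \<noteq> d" "z \<noteq> a" "z \<noteq> b" "z \<noteq> c" "z \<noteq> d"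
    using a b c d wz[of 0] wz[of 1] wz[of 2] wz[of 3] by auto
  note distinct = this this[symmetric]
  \<comment> \<open>Five distinct indices exhaust the five terms, so only \<open>a\<close>,
    \<open>b\<close>, \<open>c\<close>, \<open>d\<close> contribute to \<open>P\<close>.\<close>
  have "{a, b, c, d, z} = {..<5}"
    by (rule card_subset_eq) (use a(1) b(1) c(1) d(1) z(1) distinct in auto)
  then have expand: "gap_entry i j = w a i * h a j + w b i * h b j + w c i * h c j + w d i * h d j"
    if "i < 4" "j < 4" for i j
    using eq[of i j] that distinct wz[of i] by (simp flip: \<open>{a, b, c, d, z} = {..<5}\<close>)

  \<comment> \<open>Each entry next to the diagonal, cyclically, is met by exactly one term.\<close>
  have one: "w a 1 * h a 2 = 1" "w a 0 * h a 3 = 1" "w b 2 * h b 3 = 1" "w b 1 * h b 0 = 1"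
      "w c 3 * h c 0 = 1" "w c 2 * h c 1 = 1" "w d 0 * h d 1 = 1" "w d 3 * h d 2 = 1"
    using expand[of 1 2] expand[of 0 3] expand[of 2 3] expand[of 1 0]
      expand[of 3 0] expand[of 2 1] expand[of 0 1] expand[of 3 2] a b c d
    by (simp_all add: gap_entry_def)
  \<comment> \<open>Each entry at cyclic distance two is shared by two neighbouring terms.\<close>
  have three: "w a 0 * h a 2 + w d 0 * h d 2 = 3" "w a 1 * h a 3 + w b 1 * h b 3 = 3"
      "w b 2 * h b 0 + w c 2 * h c 0 = 3" "w c 3 * h c 1 + w d 3 * h d 1 = 3"
    using expand[of 0 2] expand[of 1 3] expand[of 2 0] expand[of 3 1] a b c d
    by (simp_all add: gap_entry_def)
  define x where "x = w a 0 * h a 2"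
  have "x \<in> \<rat>" using w[of a 0] h[of a 2] a(1) by (simp add: x_def)
  moreover have "x\<^sup>2 - 3 * x + 1 = 0"
  proof (rule cycle_equation)
    \<comment> \<open>The unknowns of the cycle are the two contributions of each term to entries 3;
      \<open>mult_one_cross\<close> makes them mutually inverse.\<close>
    show "x * (w a 1 * h a 3) = 1" "(w b 1 * h b 3) * (w b 2 * h b 0) = 1"
      "(w c 2 * h c 0) * (w c 3 * h c 1) = 1" "(w d 3 * h d 1) * (w d 0 * h d 2) = 1"
      unfolding x_def using one by (auto intro: mult_one_cross)
  qed (use three x_def in \<open>simp_all add: add.commute\<close>)
  ultimately show False using no_rational_root by blast
qed

section \<open>Explicit factorizations over the reals and the rationals\<close>

text \<open>Factors as lists and index ranges as explicit sets turn all conditions on concrete data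
  into evaluations by simp.\<close>

lemma gap_mat_factorizationI:
  fixes w h :: "real list list"
  assumes w: "length w = r" "\<forall>v\<in>set w. length v = 7 \<and> set v \<subseteq> K \<inter> {0..} \<and> \<not> set v \<subseteq> {0}"
    and h: "length h = r" "\<forall>v\<in>set h. length v = 7 \<and> set v \<subseteq> K \<inter> {0..} \<and> \<not> set v \<subseteq> {0}"
    and closed: "\<And>x y. x \<in> K \<Longrightarrow> y \<in> K \<Longrightarrow> x * y \<in> K"
    and eq: "\<forall>i\<in>{0, 1, 2, 3, 4, 5, 6}. \<forall>j\<in>{0, 1, 2, 3, 4, 5, 6}.
      gap_entry i j = (\<Sum>k<r. w ! k ! i * h ! k ! j)"
  shows "sum_of_nonneg_rank_ones K gap_mat r"
proof (rule sum_of_nonneg_rank_onesI[where n = 7 and m = 7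
      and w = "\<lambda>k i. w ! k ! i" and h = "\<lambda>k j. h ! k ! j"])
  have factor: "length (v ! k) = 7 \<and> set (v ! k) \<subseteq> K \<inter> {0..} \<and> \<not> set (v ! k) \<subseteq> {0}"
    if "v = w \<or> v = h" "k < r" for v k
    using that w h by (metis nth_mem)
  have entry: "v ! k ! i \<in> K \<and> 0 \<le> v ! k ! i" if "v = w \<or> v = h" "k < r" "i < 7" for v k i
  proof -
    have "v ! k ! i \<in> set (v ! k)" "set (v ! k) \<subseteq> K \<inter> {0..}" using factor that by auto
    then show ?thesis by auto
  qed
  have nonzero: "\<exists>i<7. v ! k ! i \<noteq> 0" if "v = w \<or> v = h" "k < r" for v k
    using factor[OF that] by (auto simp: in_set_conv_nth subset_iff)
  show "w ! k ! i * h ! k ! j \<in> K \<and> 0 \<le> w ! k ! i * h ! k ! j" if "k < r" "i < 7" "j < 7" for k i j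
    using entry[of w k i] entry[of h k j] that closed by simp
  show "\<exists>i<7. \<exists>j<7. w ! k ! i \<noteq> 0 \<and> h ! k ! j \<noteq> 0" if "k < r" for k
    using nonzero[of w k] nonzero[of h k] that by blast
  show "gap_mat $$ (i, j) = (\<Sum>k<r. w ! k ! i * h ! k ! j)" if "i < 7" "j < 7" for i j
  proof -
    have "gap_entry i j = (\<Sum>k<r. w ! k ! i * h ! k ! j)"
      using eq that unfolding less_7_cases by blast
    then show ?thesis using that by (simp add: gap_mat_def)
  qed
qed (simp add: gap_mat_def)

lemma gap_mat_real_decomposition: "sum_of_nonneg_rank_ones UNIV gap_mat 5"
proof -
  define s where "s = sqrt (5::real)"
  have ss: "s * s = 5" "s * (s * x) = 5 * x" for x
    by (simp_all add: s_def flip: mult.assoc)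
  have "2 \<le> s" unfolding s_def by (rule real_le_rsqrt) simp
  \<comment> \<open>The bound \<open>7 / 3\<close> is exactly what makes \<open>c\<close> below
    nonnegative.\<close>
  have "s \<le> 7 / 3" unfolding s_def by (rule real_le_lsqrt) (simp_all add: power2_eq_square)
  \<comment> \<open>\<open>t = 1/u = 3 - u\<close> and \<open>c = 3u - 1\<close>; \<open>\<alpha>, \<beta>\<close> are the weights of the vertices in the column \<open>(5,3,5,3)\<close>.\<close>
  define u t c \<alpha> \<beta> where
    "u = (3 - s) / 2" and "t = (3 + s) / 2" and "c = (7 - 3 * s) / 2"
    and "\<alpha> = (25 + 9 * s) / 10" and "\<beta> = (15 - s) / 10"
  note defs = this
  have nonneg: "0 \<le> u" "0 \<le> t" "0 \<le> c" "0 \<le> \<alpha>" "0 \<le> \<beta>"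
    using \<open>2 \<le> s\<close> \<open>s \<le> 7 / 3\<close> by (simp_all add: defs)
  show ?thesis
  proof (rule gap_mat_factorizationI[where
        w = "[[1, u, 0, 0, 0, t, c], [0, 1, u, 0, 0, c, t], [0, 0, 1, u, 0, t, c],
              [u, 0, 0, 1, 0, c, t], [0, 0, 0, 0, 1, 0, 0]]" and
        h = "[[0, 0, t, 1, 0, \<alpha>, \<beta>], [1, 0, 0, t, 0, \<beta>, \<alpha>], [t, 1, 0, 0, 0, \<alpha>, \<beta>],
              [0, t, 1, 0, 0, \<beta>, \<alpha>], [0, 0, 0, 0, 1, 0, 0]]"], goal_cases)
    case 6
    show ?case
      by (simp add: gap_entry_def eval_nat_numeral) (simp add: defs field_simps ss)
  qed (use nonneg in simp_all)
qed

text \<open>The chain \<open>u \<mapsto> 1/(3 - u)\<close> through \<open>5/2, 2, 1, 1/2, 2/5\<close> provides the first five left factors.\<close>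

lemma gap_mat_rational_decomposition: "sum_of_nonneg_rank_ones \<rat> gap_mat 6"
proof (rule gap_mat_factorizationI[where
      w = "[[2, 5, 0, 0, 0, 1, 13], [0, 1, 2, 0, 0, 5, 1], [0, 0, 1, 1, 0, 2, 2],
            [1, 0, 0, 2, 0, 1, 5], [5, 2, 0, 0, 0, 13, 1], [0, 0, 0, 0, 1, 0, 0]]" and
      \<comment> \<open>Left factors 0 and 4 both have support {0,1}, being the two ends of the open
        chain; the first serves column 3, the other column 2.\<close>
      h = "[[0, 0, 0, 1/2, 0, 0, 1], [1, 0, 0, 1/2, 0, 1, 0], [1, 1, 0, 0, 0, 3, 3],
            [0, 1, 1/2, 0, 0, 0, 1], [0, 0, 1/2, 0, 0, 1, 0], [0, 0, 0, 0, 1, 0, 0]]"], goal_cases)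
  case 6
  show ?case
    by (simp add: gap_entry_def eval_nat_numeral)
qed simp_all

section \<open>The three ranks of the matrix\<close>

lemma not_gap_mat_rational_decomposition_5: "\<not> sum_of_nonneg_rank_ones \<rat> gap_mat 5"
proof
  assume "sum_of_nonneg_rank_ones \<rat> gap_mat 5"
  then obtain w h :: "nat \<Rightarrow> nat \<Rightarrow> real" where
    "\<And>k i. k < 5 \<Longrightarrow> i < dim_row gap_mat \<Longrightarrow> w k i \<in> \<rat> \<and> 0 \<le> w k i"
    "\<And>k j. k < 5 \<Longrightarrow> j < dim_col gap_mat \<Longrightarrow> h k j \<in> \<rat> \<and> 0 \<le> h k j"
    "\<And>i j. i < dim_row gap_mat \<Longrightarrow> j < dim_col gap_mat \<Longrightarrow> gap_mat $$ (i, j) = (\<Sum>k<5. w k i * h k j)"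
    by (rule sum_of_nonneg_rank_onesE) (auto intro: Rats_divide)
  then show False
    by (intro gap_entries_factorization_not_rational[of w h]) (auto simp: gap_mat_def)
qed

lemma nonneg_mat_over_gap_mat: "nonneg_mat_over \<rat> gap_mat"
proof -
  have "\<forall>i\<in>{0, 1, 2, 3, 4, 5, 6}. \<forall>j\<in>{0, 1, 2, 3, 4, 5, 6}. gap_entry i j \<in> \<rat> \<and> 0 \<le> gap_entry i j"
    by (simp add: gap_entry_def)
  then have "gap_entry i j \<in> \<rat> \<and> 0 \<le> gap_entry i j" if "i < 7" "j < 7" for i j
    using that unfolding less_7_cases by blast
  then show ?thesis by (simp add: nonneg_mat_over_def gap_mat_def)
qed

theorem mainTheorem1:
  shows "\<exists>(F :: real set) (A :: real mat).
           subfield F class_ring \<and> nonneg_mat_over F A \<and>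
           mat_rank A = 5 \<and>
           nonneg_rank A UNIV = 5 \<and>
           nonneg_rank A F = 6"
proof (intro exI[of _ "\<rat>"] exI[of _ gap_mat] conjI)
  have ge5: "5 \<le> k" if "sum_of_nonneg_rank_ones K gap_mat k" for K k
    using rank_le_sum_of_nonneg_rank_ones[OF that] rank_gap_mat_ge by simp
  show "mat_rank gap_mat = 5"
    using rank_le_sum_of_nonneg_rank_ones[OF gap_mat_real_decomposition] rank_gap_mat_ge by simp
  show "nonneg_rank gap_mat UNIV = 5"
    unfolding nonneg_rank_def by (rule Least_equality, rule gap_mat_real_decomposition, rule ge5)
  have "6 \<le> k" if "sum_of_nonneg_rank_ones \<rat> gap_mat k" for k
  proof -
    have "k \<noteq> 5" using that not_gap_mat_rational_decomposition_5 by blast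
    with ge5[OF that] show ?thesis by simp
  qed
  then show "nonneg_rank gap_mat \<rat> = 6"
    unfolding nonneg_rank_def by (intro Least_equality gap_mat_rational_decomposition)
qed (rule subfield_Rats nonneg_mat_over_gap_mat)+

end
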